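(* Let $G$ be a connected graph of order at least two and let $H$ be any graph. Then the corona $G\circ H$ is a hangable graph if and only if $G$ is hangable.
   Context: All graphs are finite, simple, undirected, with nonempty vertex set. For a connected graph $G=(V_G,E_G)$, $d_G(u,v)$ is the length of a shortest $u$--$v$ path. The eccentricity of $v$ is $e_G(v)=\max\{d_G(v,u): u\in V_G\}$ and the diameter is $d(G)=\max\{e_G(v): v\in V_G\}$. The periphery of a vertex $v$ is $P_G(v)=\{u\in V_G: d_G(v,u)=e_G(v)\}$; the periphery of $G$ is $P(G)=\{v\in V_G: e_G(v)=d(G)\}$. A connected graph $G$ is hangable if $P_G(v)\subseteq P(G)$ for every $v\in V_G$. The corona $G\circ H$ of graphs $G$ and $H$ is the graph with vertex set $V_G\cup(V_G\times V_H)$ (disjoint union) and edge set $E_G\cup\bigcup_{v\in V_G}\{v(v,x): x\in V_H\}\cup\bigcup_{v\in V_G}\{(v,x)(v,y): xy\in E_H\}$. *)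

theory Defs
  imports "Graph_Theory.Digraph_Component" "Graph_Theory.Pair_Digraph"
begin

text \<open>
  Finite simple undirected graphs are values satisfying \<^const>\<open>pair_graph\<close>: a loop-free,
  symmetric set of arcs over a finite vertex set, an undirected edge \<open>uv\<close> being the two arcs
  \<open>(u, v)\<close> and \<open>(v, u)\<close>. \<^const>\<open>pair_graph\<close> admits the empty vertex set;
  \<^const>\<open>Digraph_Component.connected\<close> does not.
\<close>

definition connected_graph :: "'a pair_pre_digraph \<Rightarrow> bool" where
  "connected_graph G \<longleftrightarrow> pair_graph G \<and> Digraph_Component.connected (with_proj G)"

text \<open>
  The values below are meaningful only for connected graphs and vertices of the graph; otherwise
  \<^const>\<open>Least\<close> and \<^const>\<open>Max\<close> may be taken over an empty set.
\<close>

definition graph_dist :: "'a pair_pre_digraph \<Rightarrow> 'a \<Rightarrow> 'a \<Rightarrow> nat" where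
  "graph_dist G u v = (LEAST n. \<exists>p. pre_digraph.apath (with_proj G) u p v \<and> length p = n)"

definition eccentricity :: "'a pair_pre_digraph \<Rightarrow> 'a \<Rightarrow> nat" where
  "eccentricity G v = Max {graph_dist G v u | u. u \<in> pverts G}"

definition graph_diameter :: "'a pair_pre_digraph \<Rightarrow> nat" where
  "graph_diameter G = Max {eccentricity G v | v. v \<in> pverts G}"

definition vertex_periphery :: "'a pair_pre_digraph \<Rightarrow> 'a \<Rightarrow> 'a set" where
  "vertex_periphery G v = {u \<in> pverts G. graph_dist G v u = eccentricity G v}"

definition graph_periphery :: "'a pair_pre_digraph \<Rightarrow> 'a set" where
  "graph_periphery G = {v \<in> pverts G. eccentricity G v = graph_diameter G}"

definition hangable :: "'a pair_pre_digraph \<Rightarrow> bool" where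
  "hangable G \<longleftrightarrow> connected_graph G \<and>
     (\<forall>v \<in> pverts G. vertex_periphery G v \<subseteq> graph_periphery G)"

definition corona ::
    "'a pair_pre_digraph \<Rightarrow> 'b pair_pre_digraph \<Rightarrow> ('a + 'a \<times> 'b) pair_pre_digraph" where
  "corona G H = \<lparr>
     pverts = pverts G <+> (pverts G \<times> pverts H),
     parcs = {(Inl u, Inl v) | u v. (u, v) \<in> parcs G}
       \<union> {(Inl v, Inr (v, x)) | v x. v \<in> pverts G \<and> x \<in> pverts H}
       \<union> {(Inr (v, x), Inl v) | v x. v \<in> pverts G \<and> x \<in> pverts H}
       \<union> {(Inr (v, x), Inr (v, y)) | v x y. v \<in> pverts G \<and> (x, y) \<in> parcs H} \<rparr>"

lemma pair_graph_corona:
  assumes "pair_graph G" "pair_graph H"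
  shows "pair_graph (corona G H)"
proof -
  interpret G: pair_graph G by fact
  interpret H: pair_graph H by fact
  have wf: "pair_wf_digraph (corona G H)"
    by unfold_locales
      (auto simp: corona_def dest: G.in_arcsD1 G.in_arcsD2 H.in_arcsD1 H.in_arcsD2)
  have fin: "finite (pverts (corona G H))"
    by (simp add: corona_def G.pair_finite_verts H.pair_finite_verts)
  have "parcs (corona G H) \<subseteq> pverts (corona G H) \<times> pverts (corona G H)"
    using pair_wf_digraph.in_arcsD1[OF wf] pair_wf_digraph.in_arcsD2[OF wf] by auto
  then have fin': "finite (parcs (corona G H))"
    using fin by (meson finite_SigmaI finite_subset)
  have "sym (parcs G)" "sym (parcs H)"
    using G.pair_sym_arcs H.pair_sym_arcs by (simp_all add: symmetric_def)
  then have symm: "symmetric (with_proj (corona G H))"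
    by (auto simp: symmetric_def corona_def sym_def)
  have loop: "fst e \<noteq> snd e" if "e \<in> parcs (corona G H)" for e
    using that G.pair_no_loops H.pair_no_loops by (fastforce simp: corona_def)
  show ?thesis
    using wf fin fin' symm loop
    by (simp add: pair_graph_def pair_digraph_def pair_fin_digraph_def pair_loopfree_digraph_def
        pair_pseudo_graph_def pair_sym_digraph_def pair_fin_digraph_axioms_def
        pair_loopfree_digraph_axioms_def pair_sym_digraph_axioms_def)
qed

end

theory Submission
  imports Defs
begin

text \<open>
  Write \<open>e\<close> and \<open>d\<close> for eccentricity and diameter in \<open>G\<close>. In the corona, \<open>v\<close> has eccentricity
  \<open>e v + 1\<close> and each vertex \<open>(v, y)\<close> of its copy of \<open>H\<close> has eccentricity \<open>e v + 2\<close>; two vertices in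
  the same copy are at distance at most \<open>2 < e v + 2\<close>, as \<open>G\<close> has a second vertex. Hence \<open>v\<close> and
  \<open>(v, y)\<close> have the same periphery \<open>P\<^sub>G(v) \<times> V\<^sub>H\<close>, the diameter is \<open>d + 2\<close>, and the periphery of the
  corona is \<open>P(G) \<times> V\<^sub>H\<close>. Distances are computed by exhibiting a function that increases by at
  most one along each arc and that strictly decreases along some arc out of every vertex but the
  source.
\<close>

section \<open>Distance functions\<close>

text \<open>A certificate for distances from \<open>s\<close>: the bound along arcs makes
  \<open>f\<close> a lower bound for walk lengths, and following the predecessors back to
  \<open>s\<close> yields a walk attaining it.\<close>

definition distance_function :: "'a pair_pre_digraph \<Rightarrow> 'a \<Rightarrow> ('a \<Rightarrow> nat) \<Rightarrow> bool" where
  "distance_function G s f \<longleftrightarrow> s \<in> pverts G \<and> f s = 0 \<and>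
     (\<forall>x y. (x, y) \<in> parcs G \<longrightarrow> f y \<le> Suc (f x)) \<and>
     (\<forall>y \<in> pverts G. y \<noteq> s \<longrightarrow> (\<exists>x. (x, y) \<in> parcs G \<and> f y = Suc (f x)))"

context pair_wf_digraph
begin

text \<open>\<open>graph_dist\<close> minimises over simple paths only, while walks are easier to
  build. The extracted path repeats no arc and uses only arcs of \<open>p\<close>, so counting arcs
  gives the bound.\<close>

lemma awalk_imp_apath_length_le:
  assumes "awalk u p v"
  obtains q where "apath u q v" "length q \<le> length p"
proof
  let ?q = "awalk_to_apath p"
  show q: "apath u ?q v"
    using assms by (rule apath_awalk_to_apath)
  have "distinct ?q"
    using q by (auto simp: apath_def intro: distinct_verts_imp_distinct)
  then have "length ?q = card (set ?q)"
    by (simp add: distinct_card)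
  also have "\<dots> \<le> card (set p)"
    using awalk_to_apath_subset[OF assms] by (simp add: card_mono)
  also have "\<dots> \<le> length p"
    by (rule card_length)
  finally show "length ?q \<le> length p" .
qed

lemma graph_dist_apath:
  assumes "u \<rightarrow>\<^sup>*\<^bsub>with_proj G\<^esub> v"
  obtains p where "apath u p v" "length p = graph_dist G u v"
proof -
  have "\<exists>n p. apath u p v \<and> length p = n"
    using assms by (simp add: reachable_apath)
  from LeastI_ex[OF this] that show thesis
    unfolding graph_dist_def by blast
qed

lemma graph_dist_le_length:
  assumes "awalk u p v"
  shows "graph_dist G u v \<le> length p"
proof -
  obtain q where q: "apath u q v" "length q \<le> length p"
    using assms by (rule awalk_imp_apath_length_le)
  have "graph_dist G u v \<le> length q"
    unfolding graph_dist_def by (rule Least_le) (use q in blast)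
  with q show ?thesis by simp
qed

text \<open>Induction on the value \<open>f y\<close>: stepping to a predecessor lowers it by one,
  and value 0 occurs only at \<open>s\<close>.\<close>

lemma distance_function_awalk:
  assumes "distance_function G s f" "y \<in> pverts G"
  shows "\<exists>p. awalk s p y \<and> length p = f y"
  using assms(2)
proof (induction "f y" arbitrary: y)
  case 0
  then have "y = s"
    using assms(1) unfolding distance_function_def by (metis nat.simps(3))
  then show ?case
    using 0 by (intro exI[of _ "[]"]) (simp add: awalk_Nil_iff)
next
  case (Suc n)
  then have "y \<noteq> s"
    using assms(1) unfolding distance_function_def by (metis nat.simps(3))
  then obtain x where x: "(x, y) \<in> parcs G" "f y = Suc (f x)"
    using assms(1) Suc.prems unfolding distance_function_def by blast
  obtain p where "awalk s p x" "length p = f x"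
    using Suc.hyps(1)[of x] Suc.hyps(2) x in_arcsD1 by auto
  then have "awalk s (p @ [(x, y)]) y" "length (p @ [(x, y)]) = f y"
    using x Suc.prems by (auto simp: awalk_simps)
  then show ?case by blast
qed

text \<open>The start \<open>u\<close> is arbitrary because the induction strips the first arc of
  the walk.\<close>

lemma distance_function_le_length:
  assumes "distance_function G s f" "awalk u p v"
  shows "f v \<le> f u + length p"
  using assms(2)
proof (induction p arbitrary: u)
  case Nil
  then show ?case by (simp add: awalk_Nil_iff)
next
  case (Cons e p)
  then have "e \<in> parcs G" "u = fst e" "awalk (snd e) p v"
    by (auto simp: awalk_Cons_iff)
  moreover from this have "f (snd e) \<le> Suc (f u)"
    using assms(1) unfolding distance_function_def by (metis prod.collapse)
  ultimately show ?case
    using Cons.IH[of "snd e"] by simp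
qed

lemma distance_function_reachable:
  assumes "distance_function G s f" "y \<in> pverts G"
  shows "s \<rightarrow>\<^sup>*\<^bsub>with_proj G\<^esub> y"
  using distance_function_awalk[OF assms] by (auto simp: reachable_awalk)

lemma graph_dist_eqI:
  assumes "distance_function G s f" "y \<in> pverts G"
  shows "graph_dist G s y = f y"
proof (rule antisym)
  show "graph_dist G s y \<le> f y"
    using distance_function_awalk[OF assms] graph_dist_le_length by metis
  obtain p where "apath s p y" "length p = graph_dist G s y"
    using distance_function_reachable[OF assms] by (rule graph_dist_apath)
  then show "f y \<le> graph_dist G s y"
    using distance_function_le_length[OF assms(1), of s p y] assms(1)
    by (simp add: awalkI_apath distance_function_def)
qed

text \<open>Converse of \<open>graph_dist_eqI\<close>: the predecessor of \<open>y\<close> is the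
  tail of the last arc of a shortest path to \<open>y\<close>.\<close>

lemma distance_function_graph_dist:
  assumes s: "s \<in> pverts G" and reach: "\<And>v. v \<in> pverts G \<Longrightarrow> s \<rightarrow>\<^sup>*\<^bsub>with_proj G\<^esub> v"
  shows "distance_function G s (graph_dist G s)"
  unfolding distance_function_def
proof (intro conjI allI ballI impI)
  show "s \<in> pverts G" by fact
  show "graph_dist G s s = 0"
    using graph_dist_le_length[of s "[]" s] s by (simp add: awalk_Nil_iff)
next
  fix x y assume xy: "(x, y) \<in> parcs G"
  then have x: "x \<in> pverts G" and y: "y \<in> pverts G"
    by (auto dest: in_arcsD1 in_arcsD2)
  obtain p where p: "apath s p x" "length p = graph_dist G s x"
    using reach[OF x] by (rule graph_dist_apath)
  have "awalk s (p @ [(x, y)]) y"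
    using awalkI_apath[OF p(1)] xy y by (intro awalk_appendI) (simp_all add: awalk_simps)
  from graph_dist_le_length[OF this] p(2) show "graph_dist G s y \<le> Suc (graph_dist G s x)"
    by simp
next
  fix y assume y: "y \<in> pverts G" "y \<noteq> s"
  obtain p where p: "apath s p y" "length p = graph_dist G s y"
    using reach[OF y(1)] by (rule graph_dist_apath)
  then have w: "awalk s p y"
    by (simp add: awalkI_apath)
  then have "p \<noteq> []"
    using y(2) by (auto simp: awalk_Nil_iff)
  then obtain q e where q: "p = q @ [e]"
    by (cases p rule: rev_cases) auto
  from w have e: "e \<in> parcs G" "snd e = y" and wq: "awalk s q (fst e)"
    unfolding q by (auto simp: awalk_simps)
  then have xy: "(fst e, y) \<in> parcs G"
    by (metis prod.collapse)
  have le: "graph_dist G s (fst e) \<le> length q"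
    using wq by (rule graph_dist_le_length)
  \<comment> \<open>\<open>le\<close> gives one inequality; extending a shortest path to
    \<open>fst e\<close> by the last arc gives the other.\<close>
  obtain r where r: "apath s r (fst e)" "length r = graph_dist G s (fst e)"
    using reach[OF in_arcsD1[OF xy]] by (rule graph_dist_apath)
  have "awalk s (r @ [(fst e, y)]) y"
    using awalkI_apath[OF r(1)] xy y by (intro awalk_appendI) (simp_all add: awalk_simps)
  from graph_dist_le_length[OF this] le p(2) q r(2)
  have "graph_dist G s y = Suc (graph_dist G s (fst e))"
    by simp
  with xy show "\<exists>x. (x, y) \<in> parcs G \<and> graph_dist G s y = Suc (graph_dist G s x)"
    by blast
qed

end

section \<open>Connectivity and distance functions\<close>

lemma connected_graph_distance_function:
  assumes "connected_graph G" "s \<in> pverts G"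
  shows "distance_function G s (graph_dist G s)"
proof -
  interpret pair_graph G
    using assms(1) by (simp add: connected_graph_def)
  \<comment> \<open>Connectedness refers to the symmetric closure; symmetry of the arcs turns it
    into reachability by directed walks.\<close>
  have "strongly_connected (with_proj G)"
    using assms(1) sym_arcs
    by (auto simp: connected_graph_def intro: symmetric_connected_imp_strongly_connected)
  then show ?thesis
    using assms(2) by (intro distance_function_graph_dist) (auto simp: strongly_connected_def)
qed

lemma connected_graphI:
  assumes "pair_graph G" "pverts G \<noteq> {}"
    and "\<And>s. s \<in> pverts G \<Longrightarrow> \<exists>f. distance_function G s f"
  shows "connected_graph G"
proof -
  interpret pair_graph G by fact
  have "Digraph_Component.connected (with_proj G)"
    using assms(2,3) distance_function_reachable
    by (intro connectedI) (auto simp: reachable_mk_symmetric_eq[OF sym_arcs])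
  with assms(1) show ?thesis
    by (simp add: connected_graph_def)
qed

section \<open>Eccentricities\<close>

context pair_fin_digraph
begin

lemma eccentricity_eqI:
  assumes "\<And>u. u \<in> pverts G \<Longrightarrow> graph_dist G v u \<le> n"
    and "u \<in> pverts G" "graph_dist G v u = n"
  shows "eccentricity G v = n"
  unfolding eccentricity_def using assms pair_finite_verts
  by (intro Max_eqI) auto

lemma graph_dist_le_eccentricity:
  assumes "u \<in> pverts G"
  shows "graph_dist G v u \<le> eccentricity G v"
  unfolding eccentricity_def using assms pair_finite_verts by (intro Max_ge) auto

lemma eccentricity_attained:
  assumes "pverts G \<noteq> {}"
  obtains u where "u \<in> pverts G" "graph_dist G v u = eccentricity G v"
proof -
  have "eccentricity G v \<in> {graph_dist G v u | u. u \<in> pverts G}"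
    unfolding eccentricity_def using assms pair_finite_verts by (intro Max_in) auto
  then show thesis using that by auto
qed

lemma graph_diameter_eqI:
  assumes "\<And>v. v \<in> pverts G \<Longrightarrow> eccentricity G v \<le> n"
    and "v \<in> pverts G" "eccentricity G v = n"
  shows "graph_diameter G = n"
  unfolding graph_diameter_def using assms pair_finite_verts
  by (intro Max_eqI) auto

lemma eccentricity_le_graph_diameter:
  assumes "v \<in> pverts G"
  shows "eccentricity G v \<le> graph_diameter G"
  unfolding graph_diameter_def using assms pair_finite_verts by (intro Max_ge) auto

lemma graph_diameter_attained:
  assumes "pverts G \<noteq> {}"
  obtains v where "v \<in> pverts G" "eccentricity G v = graph_diameter G"
proof -
  have "graph_diameter G \<in> {eccentricity G v | v. v \<in> pverts G}"
    unfolding graph_diameter_def using assms pair_finite_verts by (intro Max_in) auto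
  then show thesis using that by auto
qed

end

section \<open>Distances in the corona\<close>

text \<open>\<open>H_nonempty\<close> is explicit because \<open>pair_graph\<close> admits the empty
  graph; \<open>two_verts\<close> serves to make all eccentricities in \<open>G\<close>
  positive.\<close>

locale corona_graphs = G: pair_graph G + H: pair_graph H
  for G :: "'a pair_pre_digraph" and H :: "'b pair_pre_digraph" +
  assumes conn: "connected_graph G"
    and two_verts: "card (pverts G) \<ge> 2"
    and H_nonempty: "pverts H \<noteq> {}"

sublocale corona_graphs \<subseteq> C: pair_graph "corona G H"
  by (rule pair_graph_corona) unfold_locales

context corona_graphs
begin

lemma pverts_corona [simp]:
  "Inl u \<in> pverts (corona G H) \<longleftrightarrow> u \<in> pverts G"
  "Inr (u, x) \<in> pverts (corona G H) \<longleftrightarrow> u \<in> pverts G \<and> x \<in> pverts H"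
  by (auto simp: corona_def)

lemma parcs_corona [simp]:
  "(Inl u, Inl v) \<in> parcs (corona G H) \<longleftrightarrow> (u, v) \<in> parcs G"
  "(Inl u, Inr (v, y)) \<in> parcs (corona G H) \<longleftrightarrow> u = v \<and> v \<in> pverts G \<and> y \<in> pverts H"
  "(Inr (u, x), Inl v) \<in> parcs (corona G H) \<longleftrightarrow> u = v \<and> v \<in> pverts G \<and> x \<in> pverts H"
  "(Inr (u, x), Inr (v, y)) \<in> parcs (corona G H) \<longleftrightarrow>
     u = v \<and> v \<in> pverts G \<and> (x, y) \<in> parcs H"
  by (auto simp: corona_def)

lemma pverts_corona_cases [consumes 1, case_names Inl Inr]:
  assumes "z \<in> pverts (corona G H)"
  obtains u where "z = Inl u" "u \<in> pverts G"
    | u x where "z = Inr (u, x)" "u \<in> pverts G" "x \<in> pverts H"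
  using assms by (auto simp: corona_def)

lemma G_nonempty: "pverts G \<noteq> {}"
  using two_verts by auto

lemma dist_G:
  assumes "s \<in> pverts G"
  shows "graph_dist G s s = 0"
    and "(u, v) \<in> parcs G \<Longrightarrow> graph_dist G s v \<le> Suc (graph_dist G s u)"
    and "v \<in> pverts G \<Longrightarrow> v \<noteq> s \<Longrightarrow>
      \<exists>u. (u, v) \<in> parcs G \<and> graph_dist G s v = Suc (graph_dist G s u)"
  using connected_graph_distance_function[OF conn assms]
  unfolding distance_function_def by blast+

definition dist_from_Inl :: "'a \<Rightarrow> 'a + 'a \<times> 'b \<Rightarrow> nat" where
  "dist_from_Inl u z =
     (case z of Inl v \<Rightarrow> graph_dist G u v | Inr (v, y) \<Rightarrow> Suc (graph_dist G u v))"

text \<open>Leaving the copy at \<open>u\<close> costs one arc and entering another copy one more.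
  Inside the copy, the detour through \<open>u\<close> caps distances at 2, even if \<open>H\<close>
  is disconnected.\<close>

definition dist_from_Inr :: "'a \<Rightarrow> 'b \<Rightarrow> 'a + 'a \<times> 'b \<Rightarrow> nat" where
  "dist_from_Inr u x z =
     (case z of Inl v \<Rightarrow> Suc (graph_dist G u v)
      | Inr (v, y) \<Rightarrow>
          if v \<noteq> u then graph_dist G u v + 2
          else if y = x then 0 else if (x, y) \<in> parcs H then 1 else 2)"

lemma distance_function_Inl:
  assumes u: "u \<in> pverts G"
  shows "distance_function (corona G H) (Inl u) (dist_from_Inl u)"
  unfolding distance_function_def
proof (intro conjI allI ballI impI)
  show "Inl u \<in> pverts (corona G H)" using u by simp
  show "dist_from_Inl u (Inl u) = 0" using dist_G(1)[OF u] by (simp add: dist_from_Inl_def)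
next
  fix a b assume "(a, b) \<in> parcs (corona G H)"
  then show "dist_from_Inl u b \<le> Suc (dist_from_Inl u a)"
    using dist_G(2)[OF u] by (auto simp: dist_from_Inl_def split: sum.splits prod.splits)
next
  fix b assume "b \<in> pverts (corona G H)" "b \<noteq> Inl u"
  then show "\<exists>a. (a, b) \<in> parcs (corona G H) \<and> dist_from_Inl u b = Suc (dist_from_Inl u a)"
  proof (cases rule: pverts_corona_cases)
    case (Inl v)
    then obtain w where "(w, v) \<in> parcs G" "graph_dist G u v = Suc (graph_dist G u w)"
      using dist_G(3)[OF u, of v] \<open>b \<noteq> Inl u\<close> by auto
    then show ?thesis
      using Inl by (intro exI[of _ "Inl w"]) (simp add: dist_from_Inl_def)
  next
    case (Inr v y)
    then show ?thesis
      by (intro exI[of _ "Inl v"]) (simp add: dist_from_Inl_def)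
  qed
qed

lemma distance_function_Inr:
  assumes u: "u \<in> pverts G" and x: "x \<in> pverts H"
  shows "distance_function (corona G H) (Inr (u, x)) (dist_from_Inr u x)"
  unfolding distance_function_def
proof (intro conjI allI ballI impI)
  show "Inr (u, x) \<in> pverts (corona G H)" using u x by simp
  show "dist_from_Inr u x (Inr (u, x)) = 0" by (simp add: dist_from_Inr_def)
next
  fix a b assume "(a, b) \<in> parcs (corona G H)"
  then show "dist_from_Inr u x b \<le> Suc (dist_from_Inr u x a)"
    \<comment> \<open>Inside the source's copy, an arc from the source ends at value 1, and any
      other vertex has value at least 1, so the cap 2 is never exceeded by too large a jump.\<close>
    using dist_G(1,2)[OF u]
    by (auto simp: dist_from_Inr_def split: sum.splits prod.splits)
next
  fix b assume "b \<in> pverts (corona G H)" "b \<noteq> Inr (u, x)"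
  then show "\<exists>a. (a, b) \<in> parcs (corona G H) \<and> dist_from_Inr u x b = Suc (dist_from_Inr u x a)"
  proof (cases rule: pverts_corona_cases)
    case (Inl v)
    show ?thesis
    proof (cases "v = u")
      case True
      then show ?thesis
        using Inl x dist_G(1)[OF u]
        by (intro exI[of _ "Inr (u, x)"]) (simp add: dist_from_Inr_def)
    next
      case False
      then obtain w where "(w, v) \<in> parcs G" "graph_dist G u v = Suc (graph_dist G u w)"
        using dist_G(3)[OF u, of v] Inl by auto
      then show ?thesis
        using Inl by (intro exI[of _ "Inl w"]) (simp add: dist_from_Inr_def)
    qed
  next
    case (Inr v y)
    show ?thesis
    proof (cases "v = u \<and> (x, y) \<in> parcs H")
      case True
      then show ?thesis
        using Inr \<open>b \<noteq> Inr (u, x)\<close>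
        by (intro exI[of _ "Inr (u, x)"]) (simp add: dist_from_Inr_def)
    next
      case False
      then show ?thesis
        using Inr \<open>b \<noteq> Inr (u, x)\<close> dist_G(1)[OF u]
        \<comment> \<open>The root \<open>v\<close> precedes both the vertices of other copies and,
          with value 1, the non-neighbours of \<open>x\<close> in the source's own copy.\<close>
        by (intro exI[of _ "Inl v"]) (auto simp: dist_from_Inr_def)
    qed
  qed
qed

lemmas corona_dist_Inl = C.graph_dist_eqI[OF distance_function_Inl]
lemmas corona_dist_Inr = C.graph_dist_eqI[OF distance_function_Inr]

lemma connected_corona: "connected_graph (corona G H)"
proof (rule connected_graphI)
  show "pair_graph (corona G H)" ..
  show "pverts (corona G H) \<noteq> {}"
    using G_nonempty by (auto simp: corona_def)
  show "\<exists>f. distance_function (corona G H) s f" if "s \<in> pverts (corona G H)" for s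
    using that distance_function_Inl distance_function_Inr
    by (cases rule: pverts_corona_cases) blast+
qed

section \<open>Eccentricities and diameter of the corona\<close>

lemma eccentricity_pos:
  assumes v: "v \<in> pverts G"
  shows "eccentricity G v > 0"
proof -
  have "\<not> pverts G \<subseteq> {v}"
    using two_verts card_mono[of "{v}" "pverts G"] by auto
  then obtain u where u: "u \<in> pverts G" "u \<noteq> v" by auto
  then have "graph_dist G v u > 0"
    using dist_G(3)[OF v] by fastforce
  with G.graph_dist_le_eccentricity[OF u(1), of v] show ?thesis by simp
qed

text \<open>Ensures that the copy over a farthest vertex differs from the source's own copy, so that
  the \<open>+ 2\<close> branch of \<open>dist_from_Inr\<close> applies.\<close>

lemma eccentric_neq:
  assumes "v \<in> pverts G" "graph_dist G v u = eccentricity G v"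
  shows "u \<noteq> v"
  using assms eccentricity_pos[of v] dist_G(1)[of v] by auto

lemma eccentricity_corona_Inl:
  assumes v: "v \<in> pverts G"
  shows "eccentricity (corona G H) (Inl v) = Suc (eccentricity G v)"
proof -
  obtain u where u: "u \<in> pverts G" "graph_dist G v u = eccentricity G v"
    using G_nonempty by (rule G.eccentricity_attained)
  obtain x where x: "x \<in> pverts H"
    using H_nonempty by blast
  show ?thesis
  proof (rule C.eccentricity_eqI)
    fix z assume z: "z \<in> pverts (corona G H)"
    then show "graph_dist (corona G H) (Inl v) z \<le> Suc (eccentricity G v)"
      using G.graph_dist_le_eccentricity[of _ v]
      by (cases rule: pverts_corona_cases)
        (auto simp: corona_dist_Inl[OF v] dist_from_Inl_def intro: le_SucI)
  next
    \<comment> \<open>The maximum is attained in the copy over a vertex farthest from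
      \<open>v\<close>, one arc beyond it.\<close>
    show "Inr (u, x) \<in> pverts (corona G H)" using u x by simp
    then show "graph_dist (corona G H) (Inl v) (Inr (u, x)) = Suc (eccentricity G v)"
      using u by (simp add: corona_dist_Inl[OF v] dist_from_Inl_def)
  qed
qed

lemma eccentricity_corona_Inr:
  assumes v: "v \<in> pverts G" and y: "y \<in> pverts H"
  shows "eccentricity (corona G H) (Inr (v, y)) = eccentricity G v + 2"
proof -
  obtain u where u: "u \<in> pverts G" "graph_dist G v u = eccentricity G v"
    using G_nonempty by (rule G.eccentricity_attained)
  show ?thesis
  proof (rule C.eccentricity_eqI)
    fix z assume z: "z \<in> pverts (corona G H)"
    then show "graph_dist (corona G H) (Inr (v, y)) z \<le> eccentricity G v + 2"
      using G.graph_dist_le_eccentricity[of _ v]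
      by (cases rule: pverts_corona_cases)
        (auto simp: corona_dist_Inr[OF v y] dist_from_Inr_def intro: le_SucI)
  next
    \<comment> \<open>Any vertex of \<open>H\<close> serves as second component; \<open>y\<close> is
      at hand.\<close>
    show "Inr (u, y) \<in> pverts (corona G H)" using u y by simp
    then show "graph_dist (corona G H) (Inr (v, y)) (Inr (u, y)) = eccentricity G v + 2"
      using u eccentric_neq[OF v u(2)] by (simp add: corona_dist_Inr[OF v y] dist_from_Inr_def)
  qed
qed

lemma graph_diameter_corona: "graph_diameter (corona G H) = graph_diameter G + 2"
proof -
  obtain u where u: "u \<in> pverts G" "eccentricity G u = graph_diameter G"
    using G_nonempty by (rule G.graph_diameter_attained)
  obtain x where x: "x \<in> pverts H"
    using H_nonempty by blast
  show ?thesis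
  proof (rule C.graph_diameter_eqI)
    fix z assume "z \<in> pverts (corona G H)"
    then show "eccentricity (corona G H) z \<le> graph_diameter G + 2"
      using G.eccentricity_le_graph_diameter
      by (cases rule: pverts_corona_cases)
        (auto simp: eccentricity_corona_Inl eccentricity_corona_Inr intro: le_SucI)
  next
    show "Inr (u, x) \<in> pverts (corona G H)" using u x by simp
    show "eccentricity (corona G H) (Inr (u, x)) = graph_diameter G + 2"
      using u x by (simp add: eccentricity_corona_Inr)
  qed
qed

section \<open>Peripheries in the corona\<close>

lemma graph_periphery_corona:
  "graph_periphery (corona G H) = Inr ` (graph_periphery G \<times> pverts H)"
proof (rule set_eqI)
  fix z
  show "z \<in> graph_periphery (corona G H) \<longleftrightarrow> z \<in> Inr ` (graph_periphery G \<times> pverts H)"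
  proof (cases "z \<in> pverts (corona G H)")
    case True
    then show ?thesis
    proof (cases rule: pverts_corona_cases)
      case (Inl u)
      then show ?thesis
        \<comment> \<open>A root has eccentricity at most \<open>graph_diameter G + 1\<close>, one
          short of the diameter of the corona.\<close>
        using G.eccentricity_le_graph_diameter[of u]
        by (auto simp: graph_periphery_def graph_diameter_corona eccentricity_corona_Inl)
    next
      case (Inr u x)
      then show ?thesis
        by (auto simp: graph_periphery_def graph_diameter_corona eccentricity_corona_Inr)
    qed
  next
    case False
    then show ?thesis
      by (auto simp: graph_periphery_def)
  qed
qed

lemma vertex_periphery_corona_Inl:
  assumes v: "v \<in> pverts G"
  shows "vertex_periphery (corona G H) (Inl v) = Inr ` (vertex_periphery G v \<times> pverts H)"
proof (rule set_eqI)
  fix z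
  show "z \<in> vertex_periphery (corona G H) (Inl v) \<longleftrightarrow>
      z \<in> Inr ` (vertex_periphery G v \<times> pverts H)"
  proof (cases "z \<in> pverts (corona G H)")
    case True
    then show ?thesis
    proof (cases rule: pverts_corona_cases)
      case (Inl u)
      then show ?thesis
        \<comment> \<open>Roots lie within \<open>eccentricity G v\<close> of \<open>Inl v\<close>,
          hence below its eccentricity in the corona.\<close>
        using G.graph_dist_le_eccentricity[of u v] corona_dist_Inl[OF v True]
        by (auto simp: vertex_periphery_def dist_from_Inl_def eccentricity_corona_Inl[OF v])
    next
      case (Inr u x)
      then show ?thesis
        using corona_dist_Inl[OF v True]
        by (auto simp: vertex_periphery_def dist_from_Inl_def eccentricity_corona_Inl[OF v])
    qed
  next
    case False
    then show ?thesis
      by (auto simp: vertex_periphery_def)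
  qed
qed

lemma vertex_periphery_corona_Inr:
  assumes v: "v \<in> pverts G" and y: "y \<in> pverts H"
  shows "vertex_periphery (corona G H) (Inr (v, y)) = Inr ` (vertex_periphery G v \<times> pverts H)"
proof (rule set_eqI)
  fix z
  show "z \<in> vertex_periphery (corona G H) (Inr (v, y)) \<longleftrightarrow>
      z \<in> Inr ` (vertex_periphery G v \<times> pverts H)"
  proof (cases "z \<in> pverts (corona G H)")
    case True
    then show ?thesis
    proof (cases rule: pverts_corona_cases)
      case (Inl u)
      then show ?thesis
        using G.graph_dist_le_eccentricity[of u v] corona_dist_Inr[OF v y True]
        by (auto simp: vertex_periphery_def dist_from_Inr_def eccentricity_corona_Inr[OF v y])
    next
      case (Inr u x)
      then show ?thesis
        \<comment> \<open>For \<open>u = v\<close> both sides fail: the distance is at most 2, below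
          \<open>eccentricity G v + 2\<close>, and \<open>v\<close> is not in its own periphery in
          \<open>G\<close>.\<close>
        using corona_dist_Inr[OF v y True] eccentricity_pos[OF v] eccentric_neq[OF v, of u]
        by (auto simp: vertex_periphery_def dist_from_Inr_def eccentricity_corona_Inr[OF v y]
            split: if_splits)
    qed
  next
    case False
    then show ?thesis
      by (auto simp: vertex_periphery_def)
  qed
qed

section \<open>Transfer of hangability\<close>

lemma hangable_corona_iff: "hangable (corona G H) \<longleftrightarrow> hangable G"
proof -
  \<comment> \<open>All peripheries in the corona have this product form, and a nonempty factor can
    be cancelled from an inclusion.\<close>
  have lift: "(Inr ` (A \<times> pverts H) :: ('a + 'a \<times> 'b) set) \<subseteq> Inr ` (B \<times> pverts H) \<longleftrightarrow> A \<subseteq> B"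
    for A B :: "'a set"
    using H_nonempty by auto
  have "(\<forall>z \<in> pverts (corona G H). vertex_periphery (corona G H) z \<subseteq> graph_periphery (corona G H))
    \<longleftrightarrow> (\<forall>v \<in> pverts G. vertex_periphery G v \<subseteq> graph_periphery G)" (is "?L \<longleftrightarrow> ?R")
  proof
    assume ?L
    show ?R
    proof
      fix v assume v: "v \<in> pverts G"
      \<comment> \<open>The root \<open>Inl v\<close> alone recovers the inclusion for
        \<open>v\<close>.\<close>
      with \<open>?L\<close> have "vertex_periphery (corona G H) (Inl v) \<subseteq> graph_periphery (corona G H)"
        by simp
      then show "vertex_periphery G v \<subseteq> graph_periphery G"
        by (simp only: vertex_periphery_corona_Inl[OF v] graph_periphery_corona lift)
    qed
  next
    assume R: ?R
    show ?L
    proof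
      fix z assume "z \<in> pverts (corona G H)"
      then show "vertex_periphery (corona G H) z \<subseteq> graph_periphery (corona G H)"
      proof (cases rule: pverts_corona_cases)
        case (Inl v)
        with R show ?thesis
          by (simp only: vertex_periphery_corona_Inl graph_periphery_corona lift)
      next
        case (Inr v y)
        with R show ?thesis
          by (simp only: vertex_periphery_corona_Inr graph_periphery_corona lift)
      qed
    qed
  qed
  then show ?thesis
    using conn connected_corona by (simp add: hangable_def)
qed

end

theorem theorem2:
  fixes G :: "'a pair_pre_digraph" and H :: "'b pair_pre_digraph"
  assumes "connected_graph G" and "card (pverts G) \<ge> 2"
    and "pair_graph H" and "pverts H \<noteq> {}"
  shows "hangable (corona G H) \<longleftrightarrow> hangable G"
proof -
  interpret corona_graphs G H
    using assms
    by (simp add: corona_graphs_def corona_graphs_axioms_def connected_graph_def)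
  show ?thesis by (rule hangable_corona_iff)
qed

end
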